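(* There is a bijection between alternative (generalized) composition algebras and right Moufang spherical spaces, up to choice of base point. More precisely, any alternative composition algebra with ternary product $\langle xyz\rangle=x(y^\sharp z)$ and $q$ given by $xx^\sharp=q(x)1$ is a right Moufang spherical space. For the other direction, let $(V,q)$, with ternary product $\langle xyz\rangle$, be a right Moufang spherical space, and fix $e\in V^\times$. Then: \begin{enumerate} \item $V^\times$ with $(xyz):=\frac{\langle xyz\rangle}{q(y)}$ is a ternary right Moufang loop, and every sphere $\{x\in V\mid q(x)=c\}$, $c\in\mathbb{K}^\times$, is a ternary subloop of $V^\times$. \item The bilinear product $xz:=x\cdot_e z=\frac{\langle xez\rangle}{q(e)}$ turns $V$ into an alternative algebra with neutral element $e$, and with involution $\sharp:V\to V$, $$x^\sharp=\frac{\langle exe\rangle}{q(e)}=\frac{b_q(x,e)}{q(e)}e-x,$$ and this algebra is a composition algebra with respect to the norm $N(x):=\frac{q(x)}{q(e)}$. \end{enumerate} In a similar way, alternative composition algebras also correspond to left Moufang spherical spaces.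
   Context: $\mathbb{K}$ is a commutative ring with unit ($2$ not assumed invertible). For a quadratic space $(V,q)$ ($V$ a $\mathbb{K}$-module, $q:V\to\mathbb{K}$ with $q(\lambda v)=\lambda^2q(v)$ and $b_q(u,v)=q(u+v)-q(u)-q(v)$ bilinear) put $V^\times=\{x\in V\mid q(x)\in\mathbb{K}^\times\}$. A (generalized) composition algebra is a unital, not necessarily associative $\mathbb{K}$-algebra with a scalar involution: an anti-automorphism $\sharp$ of order $2$ with $x+x^\sharp\in\mathbb{K}1$ and $xx^\sharp\in\mathbb{K}1$ for all $x$; its norm $N$ is given by $xx^\sharp=N(x)1$. Alternative means $x(xy)=(xx)y$ and $(yx)x=y(xx)$. A right Moufang spherical space is a quadratic space with $V^\times\ne\emptyset$ and a trilinear product $\langle xyz\rangle$ on $V$ such that $q(\langle xyz\rangle)=q(x)q(y)q(z)$, $\langle xxy\rangle=q(x)y=\langle yxx\rangle$, and (A1) $\langle uv\langle xyz\rangle\rangle+\langle xy\langle uvz\rangle\rangle=\langle\langle uvx\rangle yz\rangle+\langle x\langle vuy\rangle z\rangle$; (A2) $\langle\langle uvx\rangle yx\rangle=\langle uv\langle xyx\rangle\rangle$; (A3) $\langle xy\langle xyz\rangle\rangle=\langle\langle xyx\rangle yz\rangle$. A left Moufang spherical space is defined similarly, replacing (A1), (A2), (A3) by the dual identities obtained by reversing the order of arguments. Ternary loops: for a ternary product $(xyz)$ on a set $M$ write $(xyz)=L_{x,y}(z)=R_{z,y}(x)=S_{x,z}(y)$. It is a ternary loop if all $L_{x,y},R_{x,y},S_{x,y}$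 are bijective and $(xyy)=x=(yyx)$. It is a ternary inverse loop if moreover $L_{x,y}\circ L_{(yxy),y}=\mathrm{id}=L_{(yxy),y}\circ L_{x,y}$ and $R_{x,y}\circ R_{(yxy),y}=\mathrm{id}=R_{(yxy),y}\circ R_{x,y}$. A right ternary Moufang loop is a ternary inverse loop satisfying the right Chasles relation $((uzy)yx)=(uzx)$ and the identity $((abx)(bay)(baz))=(ab(xyz))$.
   Formalization: For right Moufang spherical spaces the product is (xy♯)z, not x(y♯z), which fails (A1) for octonions and serves left spaces; c↦c1 is assumed injective when q is defined by xx♯=q(x)1, and in the bijection the norm is part of the algebra. *)

theory Defs
  imports Complex_Main
begin

text \<open>The ring \<open>\<K>\<close> is a type of class \<open>comm_ring_1\<close>, and a \<open>\<K>\<close>-module is a type \<open>'v\<close> together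
  with a scalar multiplication \<open>scale\<close> satisfying the library predicate \<open>module\<close>.  All algebraic
  structures on \<open>'v\<close> are given by explicit operations.\<close>

text \<open>The inverse of a unit; the value is meaningless on non-units.\<close>

definition unit_inv :: "'k::comm_ring_1 \<Rightarrow> 'k" where
  "unit_inv c = (THE d. c * d = 1)"

section \<open>Quadratic spaces\<close>

definition polar :: "('v::ab_group_add \<Rightarrow> 'k::comm_ring_1) \<Rightarrow> 'v \<Rightarrow> 'v \<Rightarrow> 'k" where
  "polar q u v = q (u + v) - q u - q v"

definition quadratic_space ::
    "('k::comm_ring_1 \<Rightarrow> 'v::ab_group_add \<Rightarrow> 'v) \<Rightarrow> ('v \<Rightarrow> 'k) \<Rightarrow> bool" where
  "quadratic_space scale q \<longleftrightarrow>
     module scale \<and>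
     (\<forall>c v. q (scale c v) = c\<^sup>2 * q v) \<and>
     (\<forall>u. module_hom scale (*) (\<lambda>v. polar q u v)) \<and>
     (\<forall>v. module_hom scale (*) (\<lambda>u. polar q u v))"

definition units_of_form :: "('v \<Rightarrow> 'k::comm_ring_1) \<Rightarrow> 'v set" where
  "units_of_form q = {x. q x dvd 1}"

section \<open>Algebras with scalar involution\<close>

definition bilinear_product ::
    "('k::comm_ring_1 \<Rightarrow> 'v::ab_group_add \<Rightarrow> 'v) \<Rightarrow> ('v \<Rightarrow> 'v \<Rightarrow> 'v) \<Rightarrow> bool" where
  "bilinear_product scale m \<longleftrightarrow>
     (\<forall>x. module_hom scale scale (\<lambda>y. m x y)) \<and>
     (\<forall>y. module_hom scale scale (\<lambda>x. m x y))"

definition unital_algebra ::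
    "('k::comm_ring_1 \<Rightarrow> 'v::ab_group_add \<Rightarrow> 'v) \<Rightarrow> ('v \<Rightarrow> 'v \<Rightarrow> 'v) \<Rightarrow> 'v \<Rightarrow> bool" where
  "unital_algebra scale m one \<longleftrightarrow>
     module scale \<and> bilinear_product scale m \<and> (\<forall>x. m one x = x \<and> m x one = x)"

definition alternative :: "('v \<Rightarrow> 'v \<Rightarrow> 'v) \<Rightarrow> bool" where
  "alternative m \<longleftrightarrow> (\<forall>x y. m x (m x y) = m (m x x) y \<and> m (m y x) x = m y (m x x))"

text \<open>``Of order 2'' is read as \<open>\<sharp> \<circ> \<sharp> = id\<close>: the identity is allowed, as it has to be when the algebra
  is \<open>\<K>\<close> itself.\<close>

definition scalar_involution ::
    "('k::comm_ring_1 \<Rightarrow> 'v::ab_group_add \<Rightarrow> 'v) \<Rightarrow> ('v \<Rightarrow> 'v \<Rightarrow> 'v) \<Rightarrow> 'v \<Rightarrow> ('v \<Rightarrow> 'v) \<Rightarrow> bool" where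
  "scalar_involution scale m one s \<longleftrightarrow>
     module_hom scale scale s \<and>
     (\<forall>x y. s (m x y) = m (s y) (s x)) \<and>
     (\<forall>x. s (s x) = x) \<and>
     (\<forall>x. x + s x \<in> range (\<lambda>c. scale c one)) \<and>
     (\<forall>x. m x (s x) \<in> range (\<lambda>c. scale c one))"

definition composition_algebra ::
    "('k::comm_ring_1 \<Rightarrow> 'v::ab_group_add \<Rightarrow> 'v) \<Rightarrow> ('v \<Rightarrow> 'v \<Rightarrow> 'v) \<Rightarrow> 'v \<Rightarrow> ('v \<Rightarrow> 'v) \<Rightarrow> bool" where
  "composition_algebra scale m one s \<longleftrightarrow>
     unital_algebra scale m one \<and> scalar_involution scale m one s"

text \<open>The equation \<open>x x\<^sup>\<sharp> = N(x) 1\<close> determines a norm \<open>N\<close> only if \<open>c \<mapsto> c 1\<close> is injective.\<close>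

definition scalars_embed :: "('k::comm_ring_1 \<Rightarrow> 'v::ab_group_add \<Rightarrow> 'v) \<Rightarrow> 'v \<Rightarrow> bool" where
  "scalars_embed scale one \<longleftrightarrow> inj (\<lambda>c. scale c one)"

definition is_norm ::
    "('k::comm_ring_1 \<Rightarrow> 'v::ab_group_add \<Rightarrow> 'v) \<Rightarrow> ('v \<Rightarrow> 'v \<Rightarrow> 'v) \<Rightarrow> 'v \<Rightarrow> ('v \<Rightarrow> 'v) \<Rightarrow> ('v \<Rightarrow> 'k) \<Rightarrow> bool"
  where "is_norm scale m one s N \<longleftrightarrow> (\<forall>x. m x (s x) = scale (N x) one)"

text \<open>When \<open>c \<mapsto> c 1\<close> is not injective, a solution \<open>N\<close> of this equation has to be chosen, and the choice
  need not even be a quadratic form.  In that generality the norm is a part of the structure, subject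
  to the last three conditions below; for an alternative algebra in which \<open>c \<mapsto> c 1\<close> is injective they
  are consequences of the others.\<close>

definition composition_algebra_normed ::
    "('k::comm_ring_1 \<Rightarrow> 'v::ab_group_add \<Rightarrow> 'v) \<Rightarrow> ('v \<Rightarrow> 'v \<Rightarrow> 'v) \<Rightarrow> 'v \<Rightarrow> ('v \<Rightarrow> 'v) \<Rightarrow> ('v \<Rightarrow> 'k) \<Rightarrow> bool"
  where "composition_algebra_normed scale m one s N \<longleftrightarrow>
     composition_algebra scale m one s \<and> is_norm scale m one s N \<and>
     quadratic_space scale N \<and> N one = 1 \<and> (\<forall>x y. N (m x y) = N x * N y)"

section \<open>Moufang spherical spaces\<close>

definition trilinear_product ::
    "('k::comm_ring_1 \<Rightarrow> 'v::ab_group_add \<Rightarrow> 'v) \<Rightarrow> ('v \<Rightarrow> 'v \<Rightarrow> 'v \<Rightarrow> 'v) \<Rightarrow> bool" where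
  "trilinear_product scale T \<longleftrightarrow>
     (\<forall>y z. module_hom scale scale (\<lambda>x. T x y z)) \<and>
     (\<forall>x z. module_hom scale scale (\<lambda>y. T x y z)) \<and>
     (\<forall>x y. module_hom scale scale (\<lambda>z. T x y z))"

definition spherical_space ::
    "('k::comm_ring_1 \<Rightarrow> 'v::ab_group_add \<Rightarrow> 'v) \<Rightarrow> ('v \<Rightarrow> 'k) \<Rightarrow> ('v \<Rightarrow> 'v \<Rightarrow> 'v \<Rightarrow> 'v) \<Rightarrow> bool" where
  "spherical_space scale q T \<longleftrightarrow>
     quadratic_space scale q \<and> units_of_form q \<noteq> {} \<and> trilinear_product scale T \<and>
     (\<forall>x y z. q (T x y z) = q x * q y * q z) \<and>
     (\<forall>x y. T x x y = scale (q x) y \<and> T y x x = scale (q x) y)"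

definition right_moufang_space ::
    "('k::comm_ring_1 \<Rightarrow> 'v::ab_group_add \<Rightarrow> 'v) \<Rightarrow> ('v \<Rightarrow> 'k) \<Rightarrow> ('v \<Rightarrow> 'v \<Rightarrow> 'v \<Rightarrow> 'v) \<Rightarrow> bool" where
  "right_moufang_space scale q T \<longleftrightarrow>
     spherical_space scale q T \<and>
     (\<forall>u v x y z. T u v (T x y z) + T x y (T u v z) = T (T u v x) y z + T x (T v u y) z) \<and>
     (\<forall>u v x y. T (T u v x) y x = T u v (T x y x)) \<and>
     (\<forall>x y z. T x y (T x y z) = T (T x y x) y z)"

definition left_moufang_space ::
    "('k::comm_ring_1 \<Rightarrow> 'v::ab_group_add \<Rightarrow> 'v) \<Rightarrow> ('v \<Rightarrow> 'k) \<Rightarrow> ('v \<Rightarrow> 'v \<Rightarrow> 'v \<Rightarrow> 'v) \<Rightarrow> bool" where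
  "left_moufang_space scale q T \<longleftrightarrow>
     spherical_space scale q T \<and>
     (\<forall>u v x y z. T (T z y x) v u + T (T z v u) y x = T z y (T x v u) + T z (T y u v) x) \<and>
     (\<forall>u v x y. T x y (T x v u) = T (T x y x) v u) \<and>
     (\<forall>x y z. T (T z y x) y x = T z y (T x y x))"

section \<open>Ternary loops\<close>

text \<open>A ternary loop on a set \<open>M\<close>; that \<open>M\<close> is closed under the product is part of the bijectivity
  of the three kinds of translations of \<open>M\<close>.\<close>

definition ternary_loop :: "'v set \<Rightarrow> ('v \<Rightarrow> 'v \<Rightarrow> 'v \<Rightarrow> 'v) \<Rightarrow> bool" where
  "ternary_loop M P \<longleftrightarrow>
     (\<forall>x\<in>M. \<forall>y\<in>M. bij_betw (\<lambda>z. P x y z) M M) \<and>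
     (\<forall>z\<in>M. \<forall>y\<in>M. bij_betw (\<lambda>x. P x y z) M M) \<and>
     (\<forall>x\<in>M. \<forall>z\<in>M. bij_betw (\<lambda>y. P x y z) M M) \<and>
     (\<forall>x\<in>M. \<forall>y\<in>M. P x y y = x \<and> P y y x = x)"

definition ternary_subloop :: "'v set \<Rightarrow> 'v set \<Rightarrow> ('v \<Rightarrow> 'v \<Rightarrow> 'v \<Rightarrow> 'v) \<Rightarrow> bool" where
  "ternary_subloop S M P \<longleftrightarrow> ternary_loop M P \<and> S \<subseteq> M \<and> ternary_loop S P"

definition ternary_inverse_loop :: "'v set \<Rightarrow> ('v \<Rightarrow> 'v \<Rightarrow> 'v \<Rightarrow> 'v) \<Rightarrow> bool" where
  "ternary_inverse_loop M P \<longleftrightarrow>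
     ternary_loop M P \<and>
     (\<forall>x\<in>M. \<forall>y\<in>M. \<forall>w\<in>M.
        P x y (P (P y x y) y w) = w \<and> P (P y x y) y (P x y w) = w \<and>
        P (P w y (P y x y)) y x = w \<and> P (P w y x) y (P y x y) = w)"

definition right_ternary_moufang_loop :: "'v set \<Rightarrow> ('v \<Rightarrow> 'v \<Rightarrow> 'v \<Rightarrow> 'v) \<Rightarrow> bool" where
  "right_ternary_moufang_loop M P \<longleftrightarrow>
     ternary_inverse_loop M P \<and>
     (\<forall>u\<in>M. \<forall>z\<in>M. \<forall>y\<in>M. \<forall>x\<in>M. P (P u z y) y x = P u z x) \<and>
     (\<forall>a\<in>M. \<forall>b\<in>M. \<forall>x\<in>M. \<forall>y\<in>M. \<forall>z\<in>M.
        P (P a b x) (P b a y) (P b a z) = P a b (P x y z))"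

text \<open>The dual notion, with the order of the arguments reversed.\<close>

definition left_ternary_moufang_loop :: "'v set \<Rightarrow> ('v \<Rightarrow> 'v \<Rightarrow> 'v \<Rightarrow> 'v) \<Rightarrow> bool" where
  "left_ternary_moufang_loop M P \<longleftrightarrow>
     ternary_inverse_loop M P \<and>
     (\<forall>u\<in>M. \<forall>z\<in>M. \<forall>y\<in>M. \<forall>x\<in>M. P x y (P y z u) = P x z u) \<and>
     (\<forall>a\<in>M. \<forall>b\<in>M. \<forall>x\<in>M. \<forall>y\<in>M. \<forall>z\<in>M.
        P (P z a b) (P y a b) (P x b a) = P (P z y x) b a)"

definition loop_product ::
    "('k::comm_ring_1 \<Rightarrow> 'v::ab_group_add \<Rightarrow> 'v) \<Rightarrow> ('v \<Rightarrow> 'k) \<Rightarrow> ('v \<Rightarrow> 'v \<Rightarrow> 'v \<Rightarrow> 'v) \<Rightarrow>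
       'v \<Rightarrow> 'v \<Rightarrow> 'v \<Rightarrow> 'v" where
  "loop_product scale q T x y z = scale (unit_inv (q y)) (T x y z)"

section \<open>From algebras to spaces, and back after the choice of a base point\<close>

text \<open>The triple products \<open>(x y\<^sup>\<sharp>) z\<close> and \<open>x (y\<^sup>\<sharp> z)\<close>.  The first one satisfies the axioms of a right,
  the second one those of a left Moufang spherical space, and not conversely: with \<open>v = y = 1\<close> the
  first axiom of a right Moufang spherical space for \<open>x (y\<^sup>\<sharp> z)\<close> reads \<open>u (x z) = (u x) z\<close>.\<close>

definition right_triple :: "('v \<Rightarrow> 'v \<Rightarrow> 'v) \<Rightarrow> ('v \<Rightarrow> 'v) \<Rightarrow> 'v \<Rightarrow> 'v \<Rightarrow> 'v \<Rightarrow> 'v" where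
  "right_triple m s x y z = m (m x (s y)) z"

definition left_triple :: "('v \<Rightarrow> 'v \<Rightarrow> 'v) \<Rightarrow> ('v \<Rightarrow> 'v) \<Rightarrow> 'v \<Rightarrow> 'v \<Rightarrow> 'v \<Rightarrow> 'v" where
  "left_triple m s x y z = m x (m (s y) z)"

definition base_product ::
    "('k::comm_ring_1 \<Rightarrow> 'v::ab_group_add \<Rightarrow> 'v) \<Rightarrow> ('v \<Rightarrow> 'k) \<Rightarrow> ('v \<Rightarrow> 'v \<Rightarrow> 'v \<Rightarrow> 'v) \<Rightarrow> 'v \<Rightarrow>
       'v \<Rightarrow> 'v \<Rightarrow> 'v" where
  "base_product scale q T e x z = scale (unit_inv (q e)) (T x e z)"

definition base_involution ::
    "('k::comm_ring_1 \<Rightarrow> 'v::ab_group_add \<Rightarrow> 'v) \<Rightarrow> ('v \<Rightarrow> 'k) \<Rightarrow> ('v \<Rightarrow> 'v \<Rightarrow> 'v \<Rightarrow> 'v) \<Rightarrow> 'v \<Rightarrow>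
       'v \<Rightarrow> 'v" where
  "base_involution scale q T e x = scale (unit_inv (q e)) (T e x e)"

definition base_norm :: "('v \<Rightarrow> 'k::comm_ring_1) \<Rightarrow> 'v \<Rightarrow> 'v \<Rightarrow> 'k" where
  "base_norm q e x = q x * unit_inv (q e)"

definition algebra_at ::
    "('k::comm_ring_1 \<Rightarrow> 'v::ab_group_add \<Rightarrow> 'v) \<Rightarrow>
       ('v \<Rightarrow> 'k) \<times> ('v \<Rightarrow> 'v \<Rightarrow> 'v \<Rightarrow> 'v) \<times> 'v \<Rightarrow>
       ('v \<Rightarrow> 'v \<Rightarrow> 'v) \<times> 'v \<times> ('v \<Rightarrow> 'v) \<times> ('v \<Rightarrow> 'k)" where
  "algebra_at scale = (\<lambda>(q, T, e).
     (base_product scale q T e, e, base_involution scale q T e, base_norm q e))"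

text \<open>On one module, \<open>(q, T, e)\<close> and \<open>(c q, c T, e)\<close> yield the same algebra for every unit \<open>c\<close>, and the
  base point \<open>1\<close> of an algebra has norm \<open>1\<close>.  So base points are normalised by \<open>q e = 1\<close> here.\<close>

definition pointed_right_spaces ::
    "('k::comm_ring_1 \<Rightarrow> 'v::ab_group_add \<Rightarrow> 'v) \<Rightarrow>
       (('v \<Rightarrow> 'k) \<times> ('v \<Rightarrow> 'v \<Rightarrow> 'v \<Rightarrow> 'v) \<times> 'v) set" where
  "pointed_right_spaces scale = {(q, T, e). right_moufang_space scale q T \<and> q e = 1}"

definition pointed_left_spaces ::
    "('k::comm_ring_1 \<Rightarrow> 'v::ab_group_add \<Rightarrow> 'v) \<Rightarrow>
       (('v \<Rightarrow> 'k) \<times> ('v \<Rightarrow> 'v \<Rightarrow> 'v \<Rightarrow> 'v) \<times> 'v) set" where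
  "pointed_left_spaces scale = {(q, T, e). left_moufang_space scale q T \<and> q e = 1}"

definition alternative_composition_algebras ::
    "('k::comm_ring_1 \<Rightarrow> 'v::ab_group_add \<Rightarrow> 'v) \<Rightarrow>
       (('v \<Rightarrow> 'v \<Rightarrow> 'v) \<times> 'v \<times> ('v \<Rightarrow> 'v) \<times> ('v \<Rightarrow> 'k)) set" where
  "alternative_composition_algebras scale =
     {(m, one, s, N). composition_algebra_normed scale m one s N \<and> alternative m}"

end

theory Submission
  imports Defs
begin

text \<open>In an alternative algebra with scalar involution, the axioms for
  \<open>\<langle>xyz\<rangle> = (xy\<^sup>\<sharp>)z\<close> are instances of the right Moufang identity, of linearised left
  alternativity, and of the cyclic symmetry of the associator.  Conversely, after division by
  \<open>q(e)\<close>, (A2) and (A3) at the base point are the alternative laws of \<open>xz = \<langle>xez\<rangle>\<close>, polarisation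
  of \<open>q(xy) = q(x)q(y)\<close> makes \<open>x\<^sup>\<sharp> = b\<^sub>q(x, e)e - x\<close> an involution, and (A1) gives back
  \<open>\<langle>xyz\<rangle> = (xy\<^sup>\<sharp>)z\<close>.  On \<open>V\<^sup>\<times>\<close> the loop product is \<open>(xy\<^sup>-\<^sup>1)z\<close>, and the loop axioms are those
  of the Moufang loop of units.  Left spaces are the opposites of right ones.\<close>

section \<open>Alternative rings\<close>

locale alternative_ring =
  fixes m :: "'v::ab_group_add \<Rightarrow> 'v \<Rightarrow> 'v" (infixl "\<cdot>" 70)
  assumes add_left: "(x + y) \<cdot> z = x \<cdot> z + y \<cdot> z"
    and add_right: "x \<cdot> (y + z) = x \<cdot> y + x \<cdot> z"
    and left_alt: "x \<cdot> (x \<cdot> y) = x \<cdot> x \<cdot> y"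
    and right_alt: "y \<cdot> x \<cdot> x = y \<cdot> (x \<cdot> x)"
begin

lemma diff_left: "(x - y) \<cdot> z = x \<cdot> z - y \<cdot> z"
  using add_left[of "x - y" y z] by (simp add: eq_diff_eq)

lemma diff_right: "x \<cdot> (y - z) = x \<cdot> y - x \<cdot> z"
  using add_right[of x "y - z" z] by (simp add: eq_diff_eq)

lemma left_alt_add: "x \<cdot> (y \<cdot> z) + y \<cdot> (x \<cdot> z) = x \<cdot> y \<cdot> z + y \<cdot> x \<cdot> z"
  using left_alt[of "x + y" z] by (simp add: add_left add_right left_alt add_ac)

lemma right_alt_add: "z \<cdot> x \<cdot> y + z \<cdot> y \<cdot> x = z \<cdot> (x \<cdot> y) + z \<cdot> (y \<cdot> x)"
  using right_alt[of z "x + y"] by (simp add: add_left add_right right_alt add_ac)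

lemma flexible: "x \<cdot> y \<cdot> x = x \<cdot> (y \<cdot> x)"
  using left_alt_add[of x y x] by (simp add: right_alt)

lemma opposite: "alternative_ring (\<lambda>x y. y \<cdot> x)"
  by unfold_locales (simp_all add: add_left add_right left_alt right_alt)

text \<open>Linearised left alternativity makes the associator
  \<open>[x, y, z] = x \<cdot> y \<cdot> z - x \<cdot> (y \<cdot> z)\<close> skew in its first two
  arguments; the sign is absorbed by exchanging the two terms on the right.\<close>

lemma associator_swap_left: "x \<cdot> y \<cdot> z - x \<cdot> (y \<cdot> z) = y \<cdot> (x \<cdot> z) - y \<cdot> x \<cdot> z"
  using left_alt_add[of x y z] by (simp add: algebra_simps)

lemma associator_swap_right: "x \<cdot> y \<cdot> z - x \<cdot> (y \<cdot> z) = x \<cdot> (z \<cdot> y) - x \<cdot> z \<cdot> y"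
  using right_alt_add[of x y z] by (simp add: algebra_simps)

text \<open>A cyclic permutation is a product of two transpositions, so the signs cancel.\<close>

lemma associator_rotate: "x \<cdot> y \<cdot> z - x \<cdot> (y \<cdot> z) = y \<cdot> z \<cdot> x - y \<cdot> (z \<cdot> x)"
  by (metis associator_swap_left associator_swap_right minus_diff_eq)

lemma left_moufang: "x \<cdot> a \<cdot> x \<cdot> y = x \<cdot> (a \<cdot> (x \<cdot> y))"
proof -
  have "x \<cdot> a \<cdot> x \<cdot> y - x \<cdot> (a \<cdot> (x \<cdot> y)) =
      (x \<cdot> a \<cdot> x \<cdot> y - x \<cdot> a \<cdot> (x \<cdot> y)) + (x \<cdot> a \<cdot> (x \<cdot> y) - x \<cdot> (a \<cdot> (x \<cdot> y)))"
    by simp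
  \<comment> \<open>The two associators \<open>[x \<cdot> a, x, y]\<close> and
    \<open>[x, a, x \<cdot> y]\<close> are rewritten with \<open>x\<close> in first place.
    Linearised right alternativity, for \<open>x\<close> and for \<open>x \<cdot> x\<close>, then
    merges the remaining terms into left alternativity for
    \<open>a \<cdot> y + y \<cdot> a\<close>.\<close>
  also have "\<dots> = (x \<cdot> (x \<cdot> a \<cdot> y) - x \<cdot> (x \<cdot> a) \<cdot> y) + (x \<cdot> (x \<cdot> y \<cdot> a) - x \<cdot> (x \<cdot> y) \<cdot> a)"
    by (simp only: associator_swap_left[of "x \<cdot> a" x y] associator_swap_right[of x a "x \<cdot> y"])
  also have "\<dots> = x \<cdot> (x \<cdot> a \<cdot> y + x \<cdot> y \<cdot> a) - (x \<cdot> x \<cdot> a \<cdot> y + x \<cdot> x \<cdot> y \<cdot> a)"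
    by (simp add: left_alt add_right algebra_simps)
  also have "\<dots> = 0"
    by (simp only: right_alt_add) (simp add: add_right left_alt)
  finally show ?thesis
    by simp
qed

text \<open>The mirror image of \<open>left_moufang\<close>. With \<open>a = u \<cdot> s v\<close>
  and \<open>s y\<close> for \<open>y\<close> it is (A2) for \<open>right_triple\<close>.\<close>

lemma right_moufang: "a \<cdot> (x \<cdot> y \<cdot> x) = a \<cdot> x \<cdot> y \<cdot> x"
  using alternative_ring.left_moufang[OF opposite, of a x y] by (simp add: flexible)

text \<open>A case of Artin's theorem, and the content of (A3) for \<open>right_triple\<close>:
  exchanging the first two arguments of \<open>[x \<cdot> y, x, y]\<close> leaves two products that
  both equal \<open>x \<cdot> x \<cdot> (y \<cdot> y)\<close>.\<close>

lemma mult_square: "x \<cdot> y \<cdot> (x \<cdot> y) = x \<cdot> y \<cdot> x \<cdot> y"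
  using associator_swap_left[of "x \<cdot> y" x y] by (simp add: left_alt right_alt)

text \<open>The left Moufang identity lets the outer factor be pulled out of an associator:
  \<open>[x, y, z \<cdot> x] = x \<cdot> [z, x, y]\<close>. After a rotation this is
  \<open>x \<cdot> [y, z, x]\<close>, where the terms
  \<open>x \<cdot> (y \<cdot> (z \<cdot> x))\<close> on both sides agree.\<close>

lemma middle_moufang: "x \<cdot> y \<cdot> (z \<cdot> x) = x \<cdot> (y \<cdot> z) \<cdot> x"
proof -
  have "x \<cdot> y \<cdot> (z \<cdot> x) - x \<cdot> (y \<cdot> (z \<cdot> x)) = x \<cdot> (z \<cdot> x \<cdot> y) - x \<cdot> (z \<cdot> x) \<cdot> y"
    by (rule associator_swap_right)
  also have "x \<cdot> (z \<cdot> x) \<cdot> y = x \<cdot> (z \<cdot> (x \<cdot> y))"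
    by (simp only: flexible[symmetric] left_moufang)
  also have "x \<cdot> (z \<cdot> x \<cdot> y) - \<dots> = x \<cdot> (y \<cdot> z \<cdot> x - y \<cdot> (z \<cdot> x))"
    by (simp only: associator_rotate[of y z x] diff_right associator_rotate[of z x y])
      (simp only: diff_right[symmetric] associator_rotate[of z x y])
  also have "\<dots> = x \<cdot> (y \<cdot> z) \<cdot> x - x \<cdot> (y \<cdot> (z \<cdot> x))"
    by (simp add: diff_right flexible)
  finally show ?thesis
    by simp
qed

end

section \<open>The ternary loop of a set of units\<close>

text \<open>Inverses are axiomatised by their cancellation laws against all ring elements, so no
  unit element has to be named: \<open>mult_inv\<close> states that \<open>x \<cdot> i x\<close>
  acts as a left identity.\<close>

locale moufang_units = alternative_ring m for m :: "'v::ab_group_add \<Rightarrow> 'v \<Rightarrow> 'v" (infixl "\<cdot>" 70) +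
  fixes M :: "'v set" and i :: "'v \<Rightarrow> 'v"
  assumes closed: "x \<in> M \<Longrightarrow> y \<in> M \<Longrightarrow> x \<cdot> y \<in> M"
    and inv_closed: "x \<in> M \<Longrightarrow> i x \<in> M"
    and mult_inv: "x \<in> M \<Longrightarrow> x \<cdot> i x \<cdot> z = z"
    and inv_left: "x \<in> M \<Longrightarrow> i x \<cdot> (x \<cdot> z) = z"
    and inv_right: "x \<in> M \<Longrightarrow> z \<cdot> x \<cdot> i x = z"
    and inv_inv: "x \<in> M \<Longrightarrow> i (i x) = x"
    and inv_mult: "x \<in> M \<Longrightarrow> y \<in> M \<Longrightarrow> i (x \<cdot> y) = i y \<cdot> i x"
begin

definition P :: "'v \<Rightarrow> 'v \<Rightarrow> 'v \<Rightarrow> 'v" where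
  "P x y z = x \<cdot> i y \<cdot> z"

lemma inv_left': "x \<in> M \<Longrightarrow> x \<cdot> (i x \<cdot> z) = z"
  using inv_left[of "i x"] by (simp add: inv_closed inv_inv)

lemma inv_right': "x \<in> M \<Longrightarrow> z \<cdot> i x \<cdot> x = z"
  using inv_right[of "i x"] by (simp add: inv_closed inv_inv)

lemmas units_simps = closed inv_closed inv_left inv_right inv_left' inv_right' inv_inv inv_mult

text \<open>\<open>P x y\<close> is left multiplication by \<open>x \<cdot> i y\<close>, and
  \<open>P (P y x y) y\<close> is left multiplication by the inverse \<open>y \<cdot> i x\<close>.
  On the other side, the right Moufang identity splits right multiplication by
  \<open>y \<cdot> i x \<cdot> y\<close> into three successive ones, and everything cancels.\<close>

lemma P_inverse:
  assumes "x \<in> M" "y \<in> M"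
  shows "P x y (P (P y x y) y w) = w" "P (P y x y) y (P x y w) = w"
    "P (P w y (P y x y)) y x = w" "P (P w y x) y (P y x y) = w"
proof -
  show "P x y (P (P y x y) y w) = w"
    using inv_left[of "y \<cdot> i x" w] assms by (simp add: P_def units_simps)
  show "P (P y x y) y (P x y w) = w"
    using inv_left[of "x \<cdot> i y" w] assms by (simp add: P_def units_simps)
  show "P (P w y (P y x y)) y x = w" "P (P w y x) y (P y x y) = w"
    using assms by (simp_all add: P_def units_simps right_moufang)
qed

text \<open>Inverting \<open>x \<cdot> i y \<cdot> z\<close> gives
  \<open>i z \<cdot> (y \<cdot> i x)\<close>, so exchanging the outer arguments undoes the middle
  translation.\<close>

lemma P_middle_inverse:
  assumes "x \<in> M" "y \<in> M" "z \<in> M"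
  shows "P z (P x y z) x = y"
  using assms by (simp add: P_def units_simps)

lemma P_closed: "x \<in> M \<Longrightarrow> y \<in> M \<Longrightarrow> z \<in> M \<Longrightarrow> P x y z \<in> M"
  by (simp add: P_def units_simps)

text \<open>The inverses of all three kinds of translations are themselves expressed by
  \<open>P\<close>, so closure under \<open>P\<close> is enough. This covers the spheres as well as
  \<open>M\<close> itself.\<close>

lemma ternary_loop_subset:
  assumes S: "S \<subseteq> M" and P: "\<And>x y z. x \<in> S \<Longrightarrow> y \<in> S \<Longrightarrow> z \<in> S \<Longrightarrow> P x y z \<in> S"
  shows "ternary_loop S P"
  unfolding ternary_loop_def
proof (intro conjI ballI)
  fix x y assume xy: "x \<in> S" "y \<in> S"
  then have M: "x \<in> M" "y \<in> M"
    using S by auto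
  show "bij_betw (\<lambda>z. P x y z) S S"
    by (rule bij_betw_byWitness[where f' = "\<lambda>z. P (P y x y) y z"]) (use xy M in \<open>auto simp: P P_inverse\<close>)
  show "bij_betw (\<lambda>z. P z y x) S S"
    by (rule bij_betw_byWitness[where f' = "\<lambda>z. P z y (P y x y)"]) (use xy M in \<open>auto simp: P P_inverse\<close>)
  show "bij_betw (\<lambda>z. P x z y) S S"
    by (rule bij_betw_byWitness[where f' = "\<lambda>z. P y z x"])
      (use xy M S in \<open>auto simp: P P_middle_inverse subset_iff\<close>)
  show "P x y y = x" "P y y x = x"
    using M by (simp_all add: P_def inv_right' mult_inv)
qed

lemma right_ternary_moufang_loop: "right_ternary_moufang_loop M P"
  unfolding right_ternary_moufang_loop_def ternary_inverse_loop_def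
proof (intro conjI ballI)
  show "ternary_loop M P"
    by (rule ternary_loop_subset) (auto simp: P_closed)
next
  fix a b x y z assume M: "a \<in> M" "b \<in> M" "x \<in> M" "y \<in> M" "z \<in> M"
  \<comment> \<open>The elements \<open>a\<close> and \<open>b\<close> enter only through
    \<open>c\<close> and its inverse. The middle Moufang identity collects
    \<open>x \<cdot> i y\<close> between two factors \<open>c\<close>, and the left one lets the
    second factor cancel against \<open>i c\<close>.\<close>
  define c where "c = a \<cdot> i b"
  have c: "c \<in> M" "i c = b \<cdot> i a"
    using M by (auto simp: c_def units_simps)
  have "P (P a b x) (P b a y) (P b a z) = c \<cdot> x \<cdot> (i y \<cdot> c) \<cdot> (i c \<cdot> z)"
    using M c(1) by (simp add: P_def c_def[symmetric] c(2)[symmetric] units_simps)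
  also have "\<dots> = c \<cdot> (x \<cdot> i y) \<cdot> c \<cdot> (i c \<cdot> z)"
    by (simp only: middle_moufang)
  also have "\<dots> = c \<cdot> (x \<cdot> i y \<cdot> z)"
    using c(1) by (simp add: left_moufang units_simps)
  finally show "P (P a b x) (P b a y) (P b a z) = P a b (P x y z)"
    by (simp add: P_def c_def)
qed (simp_all add: P_inverse, simp add: P_def units_simps)

end

section \<open>Algebras with norm\<close>

lemma unit_inv:
  fixes c :: "'k::comm_ring_1"
  assumes "c dvd 1"
  shows "c * unit_inv c = 1"
proof -
  obtain d where d: "c * d = 1"
    using assms by (metis dvdE)
  have "d' = d" if "c * d' = 1" for d'
    using d that by (metis mult.assoc mult.commute mult_1_right)
  with d show ?thesis
    unfolding unit_inv_def by (rule theI)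
qed

lemma unit_inv_unique:
  fixes c :: "'k::comm_ring_1"
  assumes "c * d = 1"
  shows "unit_inv c = d"
proof -
  have "c * unit_inv c = 1"
    using assms by (intro unit_inv) (metis dvdI)
  then show ?thesis
    using assms by (metis mult.assoc mult.commute mult_1_right)
qed

lemma unit_inv_1 [simp]: "unit_inv (1 :: 'k::comm_ring_1) = 1"
  by (rule unit_inv_unique) simp

lemma module_mult: "module ((*) :: 'k::comm_ring_1 \<Rightarrow> _)"
  by unfold_locales (simp_all add: algebra_simps)

lemma polar_sym: "polar q u v = polar q v u"
  by (simp add: polar_def add.commute algebra_simps)

locale quadratic = module scale for scale :: "'k::comm_ring_1 \<Rightarrow> 'v::ab_group_add \<Rightarrow> 'v" +
  fixes q :: "'v \<Rightarrow> 'k"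
  assumes quadratic_space: "quadratic_space scale q"
begin

lemma q_scale: "q (scale c v) = c\<^sup>2 * q v"
  using quadratic_space by (simp add: quadratic_space_def)

lemma polar_add_right: "polar q u (v + w) = polar q u v + polar q u w"
  and polar_add_left: "polar q (v + w) u = polar q v u + polar q w u"
  and polar_scale_left: "polar q (scale c v) u = c * polar q v u"
  using quadratic_space by (simp_all add: quadratic_space_def module_hom_iff)

lemma polar_diff_left: "polar q (v - w) u = polar q v u - polar q w u"
  using polar_add_left[of "v - w" w u] by (simp add: eq_diff_eq)

lemma q_add: "q (u + v) = q u + q v + polar q u v"
  by (simp add: polar_def)

lemma polar_self: "polar q u u = 2 * q u"
  using q_scale[of 2 u] scale_left_distrib[of 1 1 u] by (simp add: polar_def)

lemma q_diff: "q (u - v) = q u + q v - polar q u v"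
  using q_add[of "u - v" v] by (simp add: polar_diff_left polar_self algebra_simps)

end

section \<open>Alternative composition algebras as right Moufang spherical spaces\<close>

locale normed_alternative_algebra =
  fixes scale :: "'k::comm_ring_1 \<Rightarrow> 'v::ab_group_add \<Rightarrow> 'v"
    and m :: "'v \<Rightarrow> 'v \<Rightarrow> 'v" (infixl "\<cdot>" 70) and one :: 'v and s :: "'v \<Rightarrow> 'v" and N :: "'v \<Rightarrow> 'k"
  assumes normed: "composition_algebra_normed scale m one s N" and alternative: "alternative m"
begin

sublocale quadratic scale N
  using normed by (simp add: quadratic_def quadratic_axioms_def quadratic_space_def
      composition_algebra_normed_def)

sublocale alternative_ring m
  using normed alternative
  by unfold_locales (simp_all add: composition_algebra_normed_def composition_algebra_def
      unital_algebra_def bilinear_product_def module_hom_iff alternative_def)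

lemma scale_mult_left: "scale c x \<cdot> y = scale c (x \<cdot> y)"
  and scale_mult_right: "x \<cdot> scale c y = scale c (x \<cdot> y)"
  and one_mult: "one \<cdot> x = x"
  and mult_one: "x \<cdot> one = x"
  and N_one: "N one = 1"
  and N_mult: "N (x \<cdot> y) = N x * N y"
  and s_add: "s (x + y) = s x + s y"
  and s_scale: "s (scale c x) = scale c (s x)"
  and s_mult: "s (x \<cdot> y) = s y \<cdot> s x"
  and s_s: "s (s x) = x"
  and mult_s: "x \<cdot> s x = scale (N x) one"
  using normed by (simp_all add: composition_algebra_normed_def composition_algebra_def
      unital_algebra_def bilinear_product_def module_hom_iff scalar_involution_def is_norm_def)

lemma s_one: "s one = one"
  by (metis mult_one one_mult s_mult s_s)

text \<open>Expanding \<open>(x + one) \<cdot> s (x + one)\<close> in two ways identifies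
  \<open>x + s x\<close>. Since \<open>s x\<close> is thus a combination of \<open>one\<close> and
  \<open>x\<close>, the alternative laws extend to products containing both \<open>x\<close> and
  \<open>s x\<close>.\<close>

lemma s_eq: "s x = scale (polar N x one) one - x"
proof -
  have "(x + one) \<cdot> s (x + one) = scale (N (x + one)) one"
    by (rule mult_s)
  then show ?thesis
    by (simp add: add_left add_right s_add s_one mult_s one_mult mult_one q_add N_one
        scale_left_distrib polar_sym[of N one x] algebra_simps)
qed

lemma s_mult_self: "s x \<cdot> x = scale (N x) one"
  using mult_s[of x]
  by (simp add: s_eq diff_left diff_right scale_mult_left scale_mult_right one_mult mult_one)

lemma N_s: "N (s x) = N x"
  by (simp add: s_eq[of x] q_diff q_scale polar_scale_left N_one polar_sym[of N one x] power2_eq_square)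

lemma mult_s_mult: "x \<cdot> (s x \<cdot> y) = scale (N x) y"
proof -
  have "x \<cdot> (s x \<cdot> y) = x \<cdot> s x \<cdot> y"
    by (simp add: s_eq diff_left diff_right scale_mult_left scale_mult_right one_mult mult_one left_alt)
  then show ?thesis
    by (simp add: mult_s scale_mult_left one_mult)
qed

lemma mult_mult_s: "y \<cdot> x \<cdot> s x = scale (N x) y"
proof -
  have "y \<cdot> x \<cdot> s x = y \<cdot> (x \<cdot> s x)"
    by (simp add: s_eq diff_left diff_right scale_mult_left scale_mult_right one_mult mult_one right_alt)
  then show ?thesis
    by (simp add: mult_s scale_mult_right mult_one)
qed

lemma s_mult_mult: "s x \<cdot> (x \<cdot> y) = scale (N x) y"
  using mult_s_mult[of "s x" y] by (simp add: s_s N_s)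

lemma mult_s_mult_self: "y \<cdot> s x \<cdot> x = scale (N x) y"
  using mult_mult_s[of y "s x"] by (simp add: s_s N_s)

lemma right_moufang_space: "right_moufang_space scale N (right_triple m s)"
  unfolding right_moufang_space_def spherical_space_def
proof (intro conjI allI)
  show "quadratic_space scale N"
    by (rule quadratic_space)
  show "units_of_form N \<noteq> {}"
    using N_one by (auto simp: units_of_form_def intro!: exI[of _ one])
  show "trilinear_product scale (right_triple m s)"
    by (simp add: trilinear_product_def right_triple_def module_hom_iff module_axioms add_left
        add_right s_add s_scale scale_mult_left scale_mult_right)
next
  fix x y z
  show "N (right_triple m s x y z) = N x * N y * N z"
    by (simp add: right_triple_def N_mult N_s)
  show "right_triple m s x x y = scale (N x) y" "right_triple m s y x x = scale (N x) y"
    by (simp_all add: right_triple_def mult_s scale_mult_left one_mult mult_s_mult_self)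
  show "right_triple m s x y (right_triple m s x y z) =
      right_triple m s (right_triple m s x y x) y z"
    by (simp add: right_triple_def left_alt mult_square)
next
  fix u v x y z
  show "right_triple m s (right_triple m s u v x) y x =
      right_triple m s u v (right_triple m s x y x)"
    by (simp add: right_triple_def right_moufang)
  \<comment> \<open>With \<open>b = x \<cdot> s y\<close>, the left side of (A1) is
    \<open>(?a \<cdot> b + b \<cdot> ?a) \<cdot> z\<close> by linearised left alternativity. As
    \<open>s (v \<cdot> s u \<cdot> y) = s y \<cdot> ?a\<close>, what remains is the cyclic symmetry
    of the associator of \<open>?a\<close>, \<open>x\<close> and \<open>s y\<close>.\<close>
  let ?a = "u \<cdot> s v"
  have "?a \<cdot> (x \<cdot> s y) + x \<cdot> s y \<cdot> ?a = ?a \<cdot> x \<cdot> s y + x \<cdot> (s y \<cdot> ?a)"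
    using associator_rotate[of ?a x "s y"] by (simp add: algebra_simps)
  then show "right_triple m s u v (right_triple m s x y z) +
        right_triple m s x y (right_triple m s u v z) =
      right_triple m s (right_triple m s u v x) y z +
        right_triple m s x (right_triple m s v u y) z"
    by (simp add: right_triple_def left_alt_add s_mult s_s add_left[symmetric])
qed

text \<open>The function \<open>n\<close> is any inverse of the norm on units. It stays a parameter
  so that for the norm \<open>q x * d\<close> it can be written with \<open>unit_inv (q x)\<close>,
  as in the loop product.\<close>

lemma moufang_units:
  assumes n: "\<And>x. N x dvd 1 \<Longrightarrow> N x * n x = 1"
  shows "moufang_units m (units_of_form N) (\<lambda>x. scale (n x) (s x))"
proof unfold_locales
  fix x z assume "x \<in> units_of_form N"
  then have x: "N x dvd 1" "N x * n x = 1" "n x * N x = 1"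
    by (auto simp: units_of_form_def n mult.commute)
  have Ni: "N (scale (n x) (s x)) = n x"
    using x(3) by (simp add: q_scale N_s power2_eq_square mult.assoc)
  then show "scale (n x) (s x) \<in> units_of_form N"
    unfolding units_of_form_def using x(3) by (metis dvdI mem_Collect_eq)
  show "x \<cdot> scale (n x) (s x) \<cdot> z = z" "scale (n x) (s x) \<cdot> (x \<cdot> z) = z"
    "z \<cdot> x \<cdot> scale (n x) (s x) = z"
    using x by (simp_all add: scale_mult_left scale_mult_right mult_s one_mult s_mult_mult mult_mult_s)
  have "n (scale (n x) (s x)) = N x"
  proof -
    have "n x * n (scale (n x) (s x)) = 1"
      using n[of "scale (n x) (s x)"] x(3) by (metis Ni dvdI)
    then show ?thesis
      using x(2) by (metis mult.assoc mult_1_left mult.commute)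
  qed
  then show "scale (n (scale (n x) (s x))) (s (scale (n x) (s x))) = x"
    using x by (simp add: s_scale s_s)
next
  fix x y assume xy: "x \<in> units_of_form N" "y \<in> units_of_form N"
  then have u: "N x * n x = 1" "N y * n y = 1"
    by (auto simp: units_of_form_def n)
  have "N (x \<cdot> y) * (n x * n y) = (N x * n x) * (N y * n y)"
    by (simp add: N_mult mult_ac)
  then have *: "N (x \<cdot> y) * (n x * n y) = 1"
    by (simp add: u)
  then have dvd: "N (x \<cdot> y) dvd 1"
    by (metis dvdI)
  then show "x \<cdot> y \<in> units_of_form N"
    by (simp add: units_of_form_def)
  have "n (x \<cdot> y) = n x * n y"
    using n[OF dvd] * by (metis mult.assoc mult_1_left mult.commute)
  then show "scale (n (x \<cdot> y)) (s (x \<cdot> y)) = scale (n y) (s y) \<cdot> scale (n x) (s x)"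
    by (simp add: s_mult scale_mult_left scale_mult_right mult.commute)
qed

lemma algebra_at_right_triple: "algebra_at scale (N, right_triple m s, one) = (m, one, s, N)"
  by (simp add: algebra_at_def base_product_def base_involution_def base_norm_def right_triple_def
      N_one s_one one_mult mult_one fun_eq_iff)

lemma algebra_at_left_triple: "algebra_at scale (N, left_triple m s, one) = (m, one, s, N)"
  by (simp add: algebra_at_def base_product_def base_involution_def base_norm_def left_triple_def
      N_one s_one one_mult mult_one fun_eq_iff)

text \<open>An anti-automorphism of a product is also one of the opposite product, so involution and
  norm are kept; \<open>s_mult_self\<close> supplies the norm equation.\<close>

lemma opposite: "normed_alternative_algebra scale (\<lambda>x y. y \<cdot> x) one s N"
proof
  show "composition_algebra_normed scale (\<lambda>x y. y \<cdot> x) one s N"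
    using normed by (auto simp: composition_algebra_normed_def composition_algebra_def
        unital_algebra_def bilinear_product_def scalar_involution_def is_norm_def s_mult_self N_mult)
  show "Defs.alternative (\<lambda>x y. y \<cdot> x)"
    using alternative by (auto simp: Defs.alternative_def)
qed

end

text \<open>As \<open>c \<mapsto> scale c one\<close> is injective, each identity between values of
  \<open>N\<close> may be checked on multiples of \<open>one\<close>, where it becomes an identity
  in the algebra. The polar form, for instance, becomes
  \<open>m x (s y) + m y (s x)\<close>.\<close>

lemma composition_algebra_normedI:
  assumes ca: "composition_algebra scale m one s" and alt: "alternative m"
    and inj: "scalars_embed scale one" and norm: "is_norm scale m one s N"
  shows "composition_algebra_normed scale m one s N"
proof -
  interpret module scale
    using ca by (simp add: composition_algebra_def unital_algebra_def)
  interpret alternative_ring m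
    using ca alt by unfold_locales (simp_all add: composition_algebra_def
      unital_algebra_def bilinear_product_def module_hom_iff alternative_def)
  have scale_mult: "m (scale c x) y = scale c (m x y)" "m x (scale c y) = scale c (m x y)"
    and one: "m one x = x" "m x one = x"
    and s: "s (x + y) = s x + s y" "s (scale c x) = scale c (s x)"
    and s_mult: "s (m x y) = m (s y) (s x)" and s_s: "s (s x) = x"
    and mult_s: "m x (s x) = scale (N x) one" for x y c
    using ca norm by (simp_all add: composition_algebra_def
      unital_algebra_def bilinear_product_def module_hom_iff scalar_involution_def is_norm_def)
  have "s x + x \<in> range (\<lambda>c. scale c one)" for x
    using ca by (simp add: composition_algebra_def scalar_involution_def add.commute)
  then have "\<exists>c. s x + x = scale c one" for x
    by blast
  then have s_eq: "\<exists>c. s x = scale c one - x" for x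
    by (metis eq_diff_eq)
  have cancel: "c = d" if "scale c one = scale d one" for c d
    using inj that by (simp add: scalars_embed_def inj_def)
  have "s one = one"
    by (metis one s_mult s_s)
  then have "N one = 1"
    using mult_s[of one] by (intro cancel) (simp add: one)
  have "N (scale c x) = c\<^sup>2 * N x" for c x
    using mult_s[of "scale c x"]
    by (intro cancel) (simp add: s scale_mult mult_s power2_eq_square mult.assoc)
  moreover have polar: "scale (polar N x y) one = m x (s y) + m y (s x)" for x y
    using mult_s[of "x + y"]
    by (simp add: polar_def scale_left_diff_distrib mult_s[symmetric] s add_left add_right)
  ultimately have "quadratic_space scale N"
    unfolding quadratic_space_def module_hom_iff
    by (auto simp: module_axioms module_mult polar s scale_mult add_left add_right scale_left_distrib
        scale_scale[symmetric] scale_right_distrib intro!: cancel simp del: scale_scale)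
  moreover have "N (m x y) = N x * N y" for x y
  proof (rule cancel)
    obtain c d where c: "s x = scale c one - x" and d: "s y = scale d one - y"
      using s_eq by blast
    have "m (m x y) (s (m x y)) = m (m x y) (m (s y) (s x))"
      by (simp add: s_mult)
    \<comment> \<open>After substituting \<open>c\<close> and \<open>d\<close>, the only term that
      is not immediate is \<open>(x y)(y x) = ((x y) y) x\<close>, a case of the middle Moufang
      identity.\<close>
    also have "\<dots> = m (m (m x y) (s y)) (s x)"
      by (simp add: c d diff_left diff_right scale_mult one right_alt left_alt middle_moufang flexible)
    also have "m (m x y) (s y) = m x (m y (s y))"
      by (simp add: d diff_right scale_mult one right_alt)
    also have "\<dots> = scale (N y) x"
      by (simp add: mult_s scale_mult one)
    finally show "scale (N (m x y)) one = scale (N x * N y) one"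
      by (simp add: mult_s scale_mult mult.commute)
  qed
  ultimately show ?thesis
    using ca norm \<open>N one = 1\<close> by (simp add: composition_algebra_normed_def)
qed

section \<open>Spherical spaces with a base point\<close>

text \<open>The normalisation \<open>q e = 1\<close> removes the divisions by \<open>q e\<close>, so
  that product and involution at \<open>e\<close> are values of \<open>T\<close>. Other base points
  are reduced to this one by \<open>right_moufang_space_normalise\<close>.\<close>

locale pointed_right_space =
  fixes scale :: "'k::comm_ring_1 \<Rightarrow> 'v::ab_group_add \<Rightarrow> 'v"
    and q :: "'v \<Rightarrow> 'k" and T :: "'v \<Rightarrow> 'v \<Rightarrow> 'v \<Rightarrow> 'v" and e :: 'v
  assumes space: "right_moufang_space scale q T" and q_e: "q e = 1"
begin

sublocale quadratic scale q
  using space by (simp add: quadratic_def quadratic_axioms_def quadratic_space_def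
      right_moufang_space_def spherical_space_def)

abbreviation m (infixl "\<cdot>" 70) where "x \<cdot> z \<equiv> T x e z"

abbreviation s where "s x \<equiv> T e x e"

lemma T_add: "T (x + x') y z = T x y z + T x' y z" "T x (y + y') z = T x y z + T x y' z"
    "T x y (z + z') = T x y z + T x y z'"
  and T_scale: "T (scale c x) y z = scale c (T x y z)" "T x (scale c y) z = scale c (T x y z)"
    "T x y (scale c z) = scale c (T x y z)"
  and q_T: "q (T x y z) = q x * q y * q z"
  and T_left: "T x x y = scale (q x) y"
  and T_right: "T y x x = scale (q x) y"
  and A1: "T u v (T x y z) + T x y (T u v z) = T (T u v x) y z + T x (T v u y) z"
  and A2: "T (T u v x) y x = T u v (T x y x)"
  and A3: "T x y (T x y z) = T (T x y x) y z"
  using space by (simp_all add: right_moufang_space_def spherical_space_def trilinear_product_def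
      module_hom_iff)

lemma T_diff: "T (x - x') y z = T x y z - T x' y z" "T x (y - y') z = T x y z - T x y' z"
    "T x y (z - z') = T x y z - T x y z'"
  using T_add(1)[of "x - x'" x' y z] T_add(2)[of x "y - y'" y' z] T_add(3)[of x y "z - z'" z']
  by (simp_all add: eq_diff_eq)

lemma T_swap: "T x y z + T y x z = scale (polar q x y) z" "T x y z + T x z y = scale (polar q y z) x"
  using T_left[of "x + y" z] T_right[of x "y + z"] unfolding T_add q_add scale_left_distrib
  by (simp_all add: T_left T_right add_ac)

lemma polar_e_e: "polar q e e = 2"
  by (simp add: polar_self q_e)

lemma e_mult: "e \<cdot> x = x" and mult_e: "x \<cdot> e = x"
  by (simp_all add: T_left T_right q_e)

lemma s_eq: "s x = scale (polar q x e) e - x"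
  using T_swap(2)[of e x e] by (simp add: T_left T_right q_e eq_diff_eq)

text \<open>Swapping the last two arguments of \<open>T x e x\<close> gives \<open>T x x e\<close>,
  which is a multiple of \<open>e\<close>: each element satisfies a quadratic equation.\<close>

lemma square: "x \<cdot> x = scale (polar q x e) x - scale (q x) e"
  using T_swap(2)[of x e x] by (simp add: T_left polar_sym[of q e x] eq_diff_eq)

lemma mult_s: "x \<cdot> s x = scale (q x) e"
  by (simp add: s_eq T_diff T_scale square mult_e)

lemma s_s: "s (s x) = x"
  by (simp add: s_eq polar_diff_left polar_scale_left polar_e_e scale_left_distrib scale_left_diff_distrib
      algebra_simps)

text \<open>Multiplicativity of \<open>q\<close> is polarised first in the left factor, then in the
  right one. Setting \<open>z\<close> and \<open>w\<close> to \<open>e\<close> yields the trace of a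
  product.\<close>

lemma polar_mult_mult: "polar q (x \<cdot> y) (z \<cdot> w) + polar q (x \<cdot> w) (z \<cdot> y) = polar q x z * polar q y w"
proof -
  have q: "q (x \<cdot> y) = q x * q y" for x y
    by (simp add: q_T q_e)
  have *: "polar q (x \<cdot> y) (z \<cdot> y) = polar q x z * q y" for x y z
    using q[of "x + z" y] by (simp add: T_add q_add q algebra_simps)
  show ?thesis
    using *[of x "y + w" z] by (simp add: T_add q_add polar_add_left polar_add_right * polar_sym[of q w y] algebra_simps)
qed

text \<open>Once both sides are expanded with \<open>s_eq\<close> and the trace of
  \<open>x \<cdot> y\<close> is known, their difference is the linearised quadratic equation for
  \<open>x \<cdot> y + y \<cdot> x\<close>.\<close>

lemma s_mult: "s (x \<cdot> y) = s y \<cdot> s x"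
proof -
  have "polar q (x \<cdot> y) e = polar q x e * polar q y e - polar q x y"
    using polar_mult_mult[of x y e e] by (simp add: e_mult mult_e eq_diff_eq)
  then have l: "s (x \<cdot> y) = scale (polar q x e * polar q y e) e - scale (polar q x y) e - x \<cdot> y"
    by (simp add: s_eq[of "x \<cdot> y"] scale_left_diff_distrib)
  have r: "s y \<cdot> s x = scale (polar q x e * polar q y e) e - scale (polar q y e) x
      - scale (polar q x e) y + y \<cdot> x"
    by (simp add: s_eq T_diff T_scale e_mult mult_e scale_right_diff_distrib mult.commute algebra_simps)
  have "x \<cdot> y + y \<cdot> x = scale (polar q x e) y + scale (polar q y e) x - scale (polar q x y) e"
    using square[of "x + y"]
    by (simp add: T_add square q_add polar_add_left scale_left_distrib scale_right_distrib algebra_simps)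
  then show ?thesis
    unfolding l r by (simp add: algebra_simps)
qed

lemma alternative: "alternative m"
  by (simp add: alternative_def A2 A3)

lemma normed: "composition_algebra_normed scale m e s q"
proof -
  have "x + s x \<in> range (\<lambda>c. scale c e)" "x \<cdot> s x \<in> range (\<lambda>c. scale c e)" for x
    by (simp add: s_eq) (simp add: mult_s)
  then show ?thesis
    by (simp add: composition_algebra_normed_def composition_algebra_def unital_algebra_def
        bilinear_product_def scalar_involution_def is_norm_def module_hom_iff module_axioms T_add
        T_scale e_mult mult_e mult_s s_mult s_s quadratic_space q_T q_e)
qed

sublocale normed_alternative_algebra scale m e s q
  by unfold_locales (fact normed, fact alternative)

text \<open>With the base point in two places, (A1) reads
  \<open>u(xz) + x(uz) = (ux)z + \<langle>x u\<^sup>\<sharp> z\<rangle>\<close>; left alternativity then leaves \<open>\<langle>x u\<^sup>\<sharp> z\<rangle> = (xu)z\<close>.\<close>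

lemma T_eq: "T x y z = right_triple m s x y z"
proof -
  have "u \<cdot> x \<cdot> z + x \<cdot> u \<cdot> z = u \<cdot> x \<cdot> z + T x (s u) z" for u
    using A1[of u e x e z] left_alt_add[of u x z] by simp
  from this[of "s y"] show ?thesis
    by (simp add: right_triple_def s_s)
qed

end

text \<open>Passing from \<open>(q, T)\<close> to \<open>(q / q e, T / q e)\<close> changes neither the algebra at \<open>e\<close> nor the loop.\<close>

lemma right_moufang_space_normalise:
  fixes scale :: "'k::comm_ring_1 \<Rightarrow> 'v::ab_group_add \<Rightarrow> 'v"
  assumes sp: "right_moufang_space scale q T" and e: "q e * d = 1"
  shows "pointed_right_space scale (\<lambda>x. q x * d) (\<lambda>x y z. scale d (T x y z)) e"
proof
  have qs: "quadratic_space scale q"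
    using sp by (simp add: right_moufang_space_def spherical_space_def)
  interpret quadratic scale q
    using qs by (simp add: quadratic_def quadratic_axioms_def quadratic_space_def)
  have polar: "polar (\<lambda>x. q x * d) u v = polar q u v * d" for u v
    by (simp add: polar_def algebra_simps)
  have "quadratic_space scale (\<lambda>x. q x * d)"
    using qs by (simp add: quadratic_space_def module_hom_iff polar distrib_right mult.assoc)
  moreover have "e \<in> units_of_form (\<lambda>x. q x * d)"
    by (simp add: units_of_form_def e)
  moreover have "trilinear_product scale (\<lambda>x y z. scale d (T x y z))"
    using sp by (simp add: right_moufang_space_def spherical_space_def trilinear_product_def
        module_hom_iff scale_right_distrib mult.commute)
  moreover have T_scale: "T (scale c x) y z = scale c (T x y z)" "T x (scale c y) z = scale c (T x y z)"
    "T x y (scale c z) = scale c (T x y z)" for c x y z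
    using sp by (simp_all add: right_moufang_space_def spherical_space_def trilinear_product_def
        module_hom_iff)
  \<comment> \<open>All axioms are homogeneous: (A1) to (A3) acquire the factor
    \<open>d\<^sup>2\<close> on both sides, the composition law the factor
    \<open>d\<^sup>3\<close>.\<close>
  ultimately show "right_moufang_space scale (\<lambda>x. q x * d) (\<lambda>x y z. scale d (T x y z))"
    using sp by (auto simp: right_moufang_space_def spherical_space_def q_scale scale_right_distrib[symmetric]
        power2_eq_square mult_ac simp del: scale_right_distrib)
qed (fact e)

text \<open>All claims are read off from the space normalised by \<open>d = 1/q(e)\<close>. There
  the inverse of a unit \<open>x\<close> is its conjugate multiplied by
  \<open>q(e)/q(x)\<close>.\<close>

lemma right_space_to_algebra:
  fixes scale :: "'k::comm_ring_1 \<Rightarrow> 'v::ab_group_add \<Rightarrow> 'v"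
  assumes sp: "right_moufang_space scale q T" and e: "e \<in> units_of_form q"
  shows "right_ternary_moufang_loop (units_of_form q) (loop_product scale q T)"
    and "c dvd 1 \<Longrightarrow> ternary_subloop {x. q x = c} (units_of_form q) (loop_product scale q T)"
    and "composition_algebra_normed scale
            (base_product scale q T e) e (base_involution scale q T e) (base_norm q e)"
    and "alternative (base_product scale q T e)"
    and "base_involution scale q T e x = scale (polar q x e * unit_inv (q e)) e - x"
    and "T x y z =
      scale (q e) (right_triple (base_product scale q T e) (base_involution scale q T e) x y z)"
proof -
  define d where "d = unit_inv (q e)"
  have d: "q e * d = 1"
    using e by (simp add: d_def units_of_form_def unit_inv)
  interpret pointed_right_space scale "\<lambda>x. q x * d" "\<lambda>x y z. scale d (T x y z)" e
    using sp d by (rule right_moufang_space_normalise)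
  have base: "base_product scale q T e = m" "base_involution scale q T e = s"
      "base_norm q e = (\<lambda>x. q x * d)"
    by (simp_all add: base_product_def base_involution_def base_norm_def d_def fun_eq_iff)
  show "composition_algebra_normed scale
            (base_product scale q T e) e (base_involution scale q T e) (base_norm q e)"
    unfolding base by (rule normed)
  show "alternative (base_product scale q T e)"
    unfolding base by (rule alternative)
  have "polar (\<lambda>x. q x * d) x e = polar q x e * d"
    by (simp add: polar_def algebra_simps)
  then show "base_involution scale q T e x = scale (polar q x e * unit_inv (q e)) e - x"
    unfolding base using s_eq[of x] by (simp add: d_def)
  have T: "T x y z = scale (q e) (right_triple m s x y z)" for x y z
    using T_eq[of x y z, symmetric] d by simp
  then show "T x y z =
      scale (q e) (right_triple (base_product scale q T e) (base_involution scale q T e) x y z)"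
    unfolding base .
  have unit: "q x * d dvd 1 \<longleftrightarrow> q x dvd 1" for x
    using mult_dvd_mono[of "q x" 1 d 1] dvd_mult_left[of "q x" d 1] d by (metis dvd_triv_right mult_1_left)
  then have M: "units_of_form (\<lambda>x. q x * d) = units_of_form q"
    by (simp add: units_of_form_def)
  have "q x * d * (unit_inv (q x) * q e) = 1" if "q x * d dvd 1" for x
  proof -
    have "q x * d * (unit_inv (q x) * q e) = (q x * unit_inv (q x)) * (q e * d)"
      by (simp add: mult_ac)
    then show ?thesis
      using that by (simp add: unit unit_inv d)
  qed
  then interpret L: moufang_units m "units_of_form q" "\<lambda>x. scale (unit_inv (q x) * q e) (s x)"
    using moufang_units[of "\<lambda>x. unit_inv (q x) * q e"] by (simp add: M)
  \<comment> \<open>The factor \<open>q e\<close> in the inverse of \<open>y\<close> is the one by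
    which \<open>T\<close> differs from the triple product of the algebra at
    \<open>e\<close>.\<close>
  have P: "loop_product scale q T = L.P"
  proof (intro ext)
    fix x y z
    show "loop_product scale q T x y z = L.P x y z"
      unfolding loop_product_def L.P_def T[of x y z] right_triple_def
      by (simp add: T_scale mult.assoc)
  qed
  show "right_ternary_moufang_loop (units_of_form q) (loop_product scale q T)"
    unfolding P by (rule L.right_ternary_moufang_loop)
  show "ternary_subloop {x. q x = c} (units_of_form q) (loop_product scale q T)" if c: "c dvd 1"
  proof -
    have q_T: "q (T x y z) = q x * q y * q z" for x y z
      using sp by (simp add: right_moufang_space_def spherical_space_def)
    have "q (loop_product scale q T x y z) = c" if "q x = c" "q y = c" "q z = c" for x y z
    proof -
      interpret q: quadratic scale q
        using sp by (simp add: quadratic_def quadratic_axioms_def quadratic_space_def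
          right_moufang_space_def spherical_space_def)
      have "q (loop_product scale q T x y z) = (c * unit_inv c) * (c * unit_inv c) * c"
        by (simp add: loop_product_def q.q_scale q_T that power2_eq_square mult_ac)
      then show ?thesis
        using c by (simp add: unit_inv)
    qed
    then have "ternary_loop {x. q x = c} L.P"
      using c by (intro L.ternary_loop_subset) (auto simp: units_of_form_def P)
    then show ?thesis
      using c L.right_ternary_moufang_loop
      by (auto simp: ternary_subloop_def P units_of_form_def right_ternary_moufang_loop_def
          ternary_inverse_loop_def)
  qed
qed

section \<open>Opposite spaces\<close>

lemma left_moufang_space_iff:
  "left_moufang_space scale q T \<longleftrightarrow> right_moufang_space scale q (\<lambda>x y z. T z y x)"
  unfolding left_moufang_space_def right_moufang_space_def spherical_space_def
    trilinear_product_def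
  by (auto simp: mult_ac)

lemma left_triple_opposite:
  "left_triple m s x y z = right_triple (\<lambda>x y. m y x) s z y x"
  by (simp add: left_triple_def right_triple_def)

text \<open>Reversal exchanges left and right translations, so the axioms of a ternary inverse loop
  are self-dual; only the Chasles relation and the Moufang identity change their form.\<close>

lemma left_ternary_moufang_loopI:
  assumes "right_ternary_moufang_loop M (\<lambda>x y z. P z y x)"
  shows "left_ternary_moufang_loop M P"
  using assms unfolding left_ternary_moufang_loop_def right_ternary_moufang_loop_def
    ternary_inverse_loop_def ternary_loop_def
  by blast

lemma ternary_subloop_opposite:
  assumes "ternary_subloop S M (\<lambda>x y z. P z y x)"
  shows "ternary_subloop S M P"
  using assms unfolding ternary_subloop_def ternary_loop_def by blast

lemma (in normed_alternative_algebra) left_moufang_space: "left_moufang_space scale N (left_triple m s)"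
  unfolding left_moufang_space_iff left_triple_opposite
  using normed_alternative_algebra.right_moufang_space[OF opposite] .

lemma composition_algebra_normed_opposite:
  assumes "composition_algebra_normed scale (\<lambda>x y. m y x) one s N" "alternative (\<lambda>x y. m y x)"
  shows "composition_algebra_normed scale m one s N" "alternative m"
  using normed_alternative_algebra.opposite[of scale "\<lambda>x y. m y x" one s N] assms
  by (simp_all add: normed_alternative_algebra_def)

lemma left_space_to_algebra:
  fixes scale :: "'k::comm_ring_1 \<Rightarrow> 'v::ab_group_add \<Rightarrow> 'v"
  assumes sp: "left_moufang_space scale q T" and e: "e \<in> units_of_form q"
  shows "left_ternary_moufang_loop (units_of_form q) (loop_product scale q T)"
    and "c dvd 1 \<Longrightarrow> ternary_subloop {x. q x = c} (units_of_form q) (loop_product scale q T)"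
    and "composition_algebra_normed scale
            (base_product scale q T e) e (base_involution scale q T e) (base_norm q e)"
    and "alternative (base_product scale q T e)"
    and "base_involution scale q T e x = scale (polar q x e * unit_inv (q e)) e - x"
    and "T x y z =
      scale (q e) (left_triple (base_product scale q T e) (base_involution scale q T e) x y z)"
proof -
  let ?T = "\<lambda>x y z. T z y x"
  \<comment> \<open>Reversal passes to the opposite product but fixes the involution, because
    \<open>T e x e\<close> is symmetric in its outer arguments.\<close>
  have loop: "loop_product scale q ?T = (\<lambda>x y z. loop_product scale q T z y x)"
    and m: "base_product scale q ?T e = (\<lambda>x z. base_product scale q T e z x)"
    and s: "base_involution scale q ?T e = base_involution scale q T e"
    by (simp_all add: fun_eq_iff loop_product_def base_product_def base_involution_def)
  note opp = right_space_to_algebra[OF sp[unfolded left_moufang_space_iff] e, unfolded loop m s]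
  show "left_ternary_moufang_loop (units_of_form q) (loop_product scale q T)"
    by (rule left_ternary_moufang_loopI) (rule opp(1))
  show "c dvd 1 \<Longrightarrow> ternary_subloop {x. q x = c} (units_of_form q) (loop_product scale q T)"
    by (rule ternary_subloop_opposite) (rule opp(2))
  show "composition_algebra_normed scale
            (base_product scale q T e) e (base_involution scale q T e) (base_norm q e)"
    "alternative (base_product scale q T e)"
    using composition_algebra_normed_opposite opp(3,4) by blast+
  show "base_involution scale q T e x = scale (polar q x e * unit_inv (q e)) e - x"
    by (rule opp(5))
  show "T x y z =
      scale (q e) (left_triple (base_product scale q T e) (base_involution scale q T e) x y z)"
    unfolding left_triple_opposite by (rule opp(6))
qed

section \<open>The correspondence\<close>

lemma bij_betw_inverses:
  assumes "\<And>a. a \<in> A \<Longrightarrow> f a \<in> B" "\<And>b. b \<in> B \<Longrightarrow> g b \<in> A"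
    and "\<And>a. a \<in> A \<Longrightarrow> g (f a) = a" "\<And>b. b \<in> B \<Longrightarrow> f (g b) = b"
  shows "bij_betw f A B" "bij_betw g B A"
  using assms by (auto intro!: bij_betw_byWitness[of A g f] bij_betw_byWitness[of B f g])

text \<open>The right and left cases differ only in the class of spaces and in the triple product,
  which are therefore parameters. The normalisation \<open>q e = 1\<close> gives
  \<open>base_norm q e = q\<close>, so passing to the algebra and back recovers the form.\<close>

lemma bij_betw_pointed_spaces:
  fixes scale :: "'k::comm_ring_1 \<Rightarrow> 'v::ab_group_add \<Rightarrow> 'v"
    and space :: "('v \<Rightarrow> 'k) \<Rightarrow> ('v \<Rightarrow> 'v \<Rightarrow> 'v \<Rightarrow> 'v) \<Rightarrow> bool"
    and triple :: "('v \<Rightarrow> 'v \<Rightarrow> 'v) \<Rightarrow> ('v \<Rightarrow> 'v) \<Rightarrow> 'v \<Rightarrow> 'v \<Rightarrow> 'v \<Rightarrow> 'v"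
  assumes to_algebra: "\<And>q T e. space q T \<Longrightarrow> q e = 1 \<Longrightarrow>
        normed_alternative_algebra scale (base_product scale q T e) e (base_involution scale q T e) (base_norm q e) \<and>
        triple (base_product scale q T e) (base_involution scale q T e) = T"
    and to_space: "\<And>m one s N. normed_alternative_algebra scale m one s N \<Longrightarrow>
        space N (triple m s) \<and> algebra_at scale (N, triple m s, one) = (m, one, s, N)"
  shows "bij_betw (algebra_at scale) {(q, T, e). space q T \<and> q e = 1}
        (alternative_composition_algebras scale)"
    and "bij_betw (\<lambda>(m, one, s, N). (N, triple m s, one))
        (alternative_composition_algebras scale) {(q, T, e). space q T \<and> q e = 1}"
proof -
  have algebras: "(m, one, s, N) \<in> alternative_composition_algebras scale \<longleftrightarrow>
      normed_alternative_algebra scale m one s N" for m one s N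
    by (simp add: alternative_composition_algebras_def normed_alternative_algebra_def)
  have base_norm: "base_norm q e = q" if "q e = 1" for q :: "'v \<Rightarrow> 'k" and e
    by (simp add: fun_eq_iff base_norm_def that)
  have f: "algebra_at scale x \<in> alternative_composition_algebras scale"
    "(\<lambda>(m, one, s, N). (N, triple m s, one)) (algebra_at scale x) = x"
    if "x \<in> {(q, T, e). space q T \<and> q e = 1}" for x
    using that to_algebra base_norm by (auto simp: algebra_at_def algebras)
  have g: "(\<lambda>(m, one, s, N). (N, triple m s, one)) y \<in> {(q, T, e). space q T \<and> q e = 1}"
    "algebra_at scale ((\<lambda>(m, one, s, N). (N, triple m s, one)) y) = y"
    if y: "y \<in> alternative_composition_algebras scale" for y
  proof -
    obtain m one s N where [simp]: "y = (m, one, s, N)"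
      by (cases y)
    have "normed_alternative_algebra scale m one s N"
      using y by (simp add: algebras)
    from to_space[OF this] normed_alternative_algebra.N_one[OF this]
    show "(\<lambda>(m, one, s, N). (N, triple m s, one)) y \<in> {(q, T, e). space q T \<and> q e = 1}"
      "algebra_at scale ((\<lambda>(m, one, s, N). (N, triple m s, one)) y) = y"
      by simp_all
  qed
  show "bij_betw (algebra_at scale) {(q, T, e). space q T \<and> q e = 1}
        (alternative_composition_algebras scale)"
    "bij_betw (\<lambda>(m, one, s, N). (N, triple m s, one))
        (alternative_composition_algebras scale) {(q, T, e). space q T \<and> q e = 1}"
    by (rule bij_betw_inverses; fact f g)+
qed

lemma bij_betw_right_spaces:
  fixes scale :: "'k::comm_ring_1 \<Rightarrow> 'v::ab_group_add \<Rightarrow> 'v"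
  assumes "module scale"
  shows "bij_betw (algebra_at scale) (pointed_right_spaces scale) (alternative_composition_algebras scale)"
    and "bij_betw (\<lambda>(m, one, s, N). (N, right_triple m s, one))
      (alternative_composition_algebras scale) (pointed_right_spaces scale)"
proof -
  have "normed_alternative_algebra scale (base_product scale q T e) e (base_involution scale q T e) (base_norm q e) \<and>
      right_triple (base_product scale q T e) (base_involution scale q T e) = T"
    if sp: "right_moufang_space scale q T" and q_e: "q e = 1" for q T e
  proof -
    have "e \<in> units_of_form q"
      by (simp add: units_of_form_def q_e)
    note alg = right_space_to_algebra(3,4,6)[OF sp this]
    then show ?thesis
      using module.scale_one[OF assms] by (simp add: normed_alternative_algebra_def fun_eq_iff q_e)
  qed
  note bij = bij_betw_pointed_spaces[of "right_moufang_space scale" scale right_triple, OF this]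
  show "bij_betw (algebra_at scale) (pointed_right_spaces scale) (alternative_composition_algebras scale)"
    "bij_betw (\<lambda>(m, one, s, N). (N, right_triple m s, one))
      (alternative_composition_algebras scale) (pointed_right_spaces scale)"
    unfolding pointed_right_spaces_def
    by (intro bij conjI; simp add: normed_alternative_algebra.right_moufang_space
        normed_alternative_algebra.algebra_at_right_triple)+
qed

lemma bij_betw_left_spaces:
  fixes scale :: "'k::comm_ring_1 \<Rightarrow> 'v::ab_group_add \<Rightarrow> 'v"
  assumes "module scale"
  shows "bij_betw (algebra_at scale) (pointed_left_spaces scale) (alternative_composition_algebras scale)"
    and "bij_betw (\<lambda>(m, one, s, N). (N, left_triple m s, one))
      (alternative_composition_algebras scale) (pointed_left_spaces scale)"
proof -
  have "normed_alternative_algebra scale (base_product scale q T e) e (base_involution scale q T e) (base_norm q e) \<and>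
      left_triple (base_product scale q T e) (base_involution scale q T e) = T"
    if sp: "left_moufang_space scale q T" and q_e: "q e = 1" for q T e
  proof -
    have "e \<in> units_of_form q"
      by (simp add: units_of_form_def q_e)
    note alg = left_space_to_algebra(3,4,6)[OF sp this]
    then show ?thesis
      using module.scale_one[OF assms] by (simp add: normed_alternative_algebra_def fun_eq_iff q_e)
  qed
  note bij = bij_betw_pointed_spaces[of "left_moufang_space scale" scale left_triple, OF this]
  show "bij_betw (algebra_at scale) (pointed_left_spaces scale) (alternative_composition_algebras scale)"
    "bij_betw (\<lambda>(m, one, s, N). (N, left_triple m s, one))
      (alternative_composition_algebras scale) (pointed_left_spaces scale)"
    unfolding pointed_left_spaces_def
    by (intro bij conjI; simp add: normed_alternative_algebra.left_moufang_space
        normed_alternative_algebra.algebra_at_left_triple)+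
qed

theorem theorem8p2:
  fixes scale :: "'k::comm_ring_1 \<Rightarrow> 'v::ab_group_add \<Rightarrow> 'v"
  assumes "module scale"
  shows
    "\<comment> \<open>the bijections, with explicit mutually inverse maps\<close>
     (bij_betw (algebra_at scale)
        (pointed_right_spaces scale) (alternative_composition_algebras scale) \<and>
      bij_betw (\<lambda>(m, one, s, N). (N, right_triple m s, one))
        (alternative_composition_algebras scale) (pointed_right_spaces scale) \<and>
      (\<forall>m one s N. (m, one, s, N) \<in> alternative_composition_algebras scale \<longrightarrow>
         algebra_at scale (N, right_triple m s, one) = (m, one, s, N)) \<and>
      bij_betw (algebra_at scale)
        (pointed_left_spaces scale) (alternative_composition_algebras scale) \<and>
      bij_betw (\<lambda>(m, one, s, N). (N, left_triple m s, one))
        (alternative_composition_algebras scale) (pointed_left_spaces scale) \<and>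
      (\<forall>m one s N. (m, one, s, N) \<in> alternative_composition_algebras scale \<longrightarrow>
         algebra_at scale (N, left_triple m s, one) = (m, one, s, N))) \<and>
     \<comment> \<open>from algebras to spaces\<close>
     (\<forall>m one s q.
        composition_algebra scale m one s \<and> alternative m \<and>
        scalars_embed scale one \<and> is_norm scale m one s q \<longrightarrow>
          right_moufang_space scale q (right_triple m s) \<and>
          left_moufang_space scale q (left_triple m s) \<and>
          composition_algebra_normed scale m one s q) \<and>
     \<comment> \<open>from right Moufang spherical spaces to algebras\<close>
     (\<forall>q T e.
        right_moufang_space scale q T \<and> e \<in> units_of_form q \<longrightarrow>
          right_ternary_moufang_loop (units_of_form q) (loop_product scale q T) \<and>
          (\<forall>c. c dvd 1 \<longrightarrow>
             ternary_subloop {x. q x = c} (units_of_form q) (loop_product scale q T)) \<and>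
          composition_algebra_normed scale
            (base_product scale q T e) e (base_involution scale q T e) (base_norm q e) \<and>
          alternative (base_product scale q T e) \<and>
          (\<forall>x. base_involution scale q T e x =
             scale (polar q x e * unit_inv (q e)) e - x) \<and>
          (\<forall>x y z. T x y z =
             scale (q e) (right_triple (base_product scale q T e) (base_involution scale q T e) x y z))) \<and>
     \<comment> \<open>from left Moufang spherical spaces to algebras\<close>
     (\<forall>q T e.
        left_moufang_space scale q T \<and> e \<in> units_of_form q \<longrightarrow>
          left_ternary_moufang_loop (units_of_form q) (loop_product scale q T) \<and>
          (\<forall>c. c dvd 1 \<longrightarrow>
             ternary_subloop {x. q x = c} (units_of_form q) (loop_product scale q T)) \<and>
          composition_algebra_normed scale
            (base_product scale q T e) e (base_involution scale q T e) (base_norm q e) \<and>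
          alternative (base_product scale q T e) \<and>
          (\<forall>x. base_involution scale q T e x =
             scale (polar q x e * unit_inv (q e)) e - x) \<and>
          (\<forall>x y z. T x y z =
             scale (q e) (left_triple (base_product scale q T e) (base_involution scale q T e) x y z)))"
proof (intro conjI allI impI; (elim conjE)?)
  fix m one s N
  assume "(m, one, s, N) \<in> alternative_composition_algebras scale"
  then interpret normed_alternative_algebra scale m one s N
    by (simp add: alternative_composition_algebras_def normed_alternative_algebra_def)
  show "algebra_at scale (N, right_triple m s, one) = (m, one, s, N)"
    "algebra_at scale (N, left_triple m s, one) = (m, one, s, N)"
    by (fact algebra_at_right_triple algebra_at_left_triple)+
next
  fix m one s q
  assume A: "composition_algebra scale m one s" "alternative m" "scalars_embed scale one"
    "is_norm scale m one s q"
  then show normed: "composition_algebra_normed scale m one s q"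
    by (rule composition_algebra_normedI)
  then interpret normed_alternative_algebra scale m one s q
    using A(2) by unfold_locales
  show "right_moufang_space scale q (right_triple m s)" "left_moufang_space scale q (left_triple m s)"
    by (fact right_moufang_space left_moufang_space)+
qed (simp_all only: assms bij_betw_right_spaces bij_betw_left_spaces
    right_space_to_algebra(1-5) left_space_to_algebra(1-5),
    (erule (1) right_space_to_algebra(6) left_space_to_algebra(6))+)

end
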